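(* Let $X,Y\in\mathcal L^\dagger(\mathcal D,\mathcal H)$. The strong multiplication $X\circ Y$ is well-defined if and only if there exists $W\in\mathcal L^\dagger(\mathcal D,\mathcal H)$ such that $$\varphi_\xi(WA,Z^\dagger B)=\varphi_\xi(YA,(X^\dagger\,\Box\, Z^\dagger)B)\quad\text{whenever } Z\in L^{\rm w}(X),\ \forall\,\xi\in\mathcal D,\ \forall\, A,B\in\mathfrak P,$$ and $$\varphi_\xi(W^\dagger A,VB)=\varphi_\xi(X^\dagger A,(Y\,\Box\, V)B)\quad\text{whenever } V\in R^{\rm w}(Y),\ \forall\,\xi\in\mathcal D,\ \forall\, A,B\in\mathfrak P.$$
   Context: $\mathcal H$ is a complex Hilbert space with inner product $\langle\cdot|\cdot\rangle$ (linear in the first variable) and $\mathcal D$ is a dense subspace of $\mathcal H$. $\mathcal L^\dagger(\mathcal D,\mathcal H)$ is the set of all (closable) linear operators $X$ in $\mathcal H$ with domain $D(X)=\mathcal D$ and $D(X^* )\supseteq\mathcal D$; $X^\dagger:=X^*\upharpoonright\mathcal D$, and $\overline X$ is the closure of $X$. Weak multiplication: $X_1\,\Box\, X_2$ is well-defined (written $X_1\in L^{\rm w}(X_2)$, or $X_2\in R^{\rm w}(X_1)$) if there is $Z\in\mathcal L^\dagger(\mathcal D,\mathcal H)$ with $\langle X_2\xi|X_1^\dagger\eta\rangle=\langle Z\xi|\eta\rangle$ for all $\xi,\eta\in\mathcal D$; then $X_1\,\Box\, X_2:=Z$. Strong multiplication: $X\circ Y$ is well-defined if $Y\mathcal D\subset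 D(\overline X)$ and $X^\dagger\mathcal D\subset D(\overline{Y^\dagger})$; then $(X\circ Y)\xi=\overline X(Y\xi)$ for $\xi\in\mathcal D$. $\mathfrak P:=\{A\in\mathcal L^\dagger(\mathcal D,\mathcal H): A \text{ is bounded and } A\mathcal D\subset\mathcal D,\ A^\dagger\mathcal D\subset\mathcal D\}$. For $T\in\mathcal L^\dagger(\mathcal D,\mathcal H)$ and $A\in\mathfrak P$, $TA$ denotes the product $T\,\Box\,A$ (the composition on $\mathcal D$), which always exists in $\mathcal L^\dagger(\mathcal D,\mathcal H)$. For $\xi\in\mathcal D$, $\varphi_\xi(S,T):=\langle S\xi|T\xi\rangle$, $S,T\in\mathcal L^\dagger(\mathcal D,\mathcal H)$. *)

theory Defs
  imports "HOL-Analysis.Analysis"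
begin

class complex_hilbert = banach +
  fixes scaleC :: "complex \<Rightarrow> 'a \<Rightarrow> 'a" (infixr "*\<^sub>C" 75)
    and cinner :: "'a \<Rightarrow> 'a \<Rightarrow> complex"
  assumes scaleC_add_right: "a *\<^sub>C (x + y) = a *\<^sub>C x + a *\<^sub>C y"
    and scaleC_add_left: "(a + b) *\<^sub>C x = a *\<^sub>C x + b *\<^sub>C x"
    and scaleC_scaleC: "a *\<^sub>C b *\<^sub>C x = (a * b) *\<^sub>C x"
    and scaleR_scaleC: "r *\<^sub>R x = complex_of_real r *\<^sub>C x"
    and cinner_commute: "cinner x y = cnj (cinner y x)"
    and cinner_add_left: "cinner (x + y) z = cinner x z + cinner y z"
    and cinner_scaleC_left: "cinner (a *\<^sub>C x) y = a * cinner x y"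
    and cinner_norm: "cinner x x = complex_of_real ((norm x)\<^sup>2)"

global_interpretation complex_vector:
  vector_space "scaleC :: complex \<Rightarrow> 'a \<Rightarrow> 'a::complex_hilbert"
proof
  show "1 *\<^sub>C x = x" for x :: 'a
    using scaleR_scaleC[of 1 x] by simp
qed (simp_all add: scaleC_add_right scaleC_add_left scaleC_scaleC)

instantiation complex :: complex_hilbert
begin

definition "a *\<^sub>C (x::complex) = a * x"
definition "cinner (x::complex) y = x * cnj y"

instance
  by standard
    (auto simp: scaleC_complex_def cinner_complex_def algebra_simps scaleR_conv_of_real
      complex_norm_square[symmetric])

end

text \<open>
  A partially defined operator in a Hilbert space is a partial function; its domain is \<open>dom X\<close>,
  its graph is \<open>Map.graph X\<close>, and its value at \<open>\<xi> \<in> dom X\<close> is \<open>the (X \<xi>)\<close>.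
\<close>

definition linear_operator :: "('h::complex_hilbert \<rightharpoonup> 'h) \<Rightarrow> bool" where
  "linear_operator X \<longleftrightarrow> complex_vector.subspace (dom X) \<and>
     (\<forall>\<xi>\<in>dom X. \<forall>\<eta>\<in>dom X. the (X (\<xi> + \<eta>)) = the (X \<xi>) + the (X \<eta>)) \<and>
     (\<forall>c. \<forall>\<xi>\<in>dom X. the (X (c *\<^sub>C \<xi>)) = c *\<^sub>C the (X \<xi>))"

definition adjoint_rel :: "('h::complex_hilbert \<rightharpoonup> 'h) \<Rightarrow> 'h \<Rightarrow> 'h \<Rightarrow> bool" where
  "adjoint_rel X \<eta> \<zeta> \<longleftrightarrow> (\<forall>\<xi>\<in>dom X. cinner (the (X \<xi>)) \<eta> = cinner \<xi> \<zeta>)"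

text \<open>The adjoint \<open>X\<^sup>*\<close>; the vector \<open>\<zeta>\<close> is unique when \<open>X\<close> is densely defined.\<close>

definition adjoint_op :: "('h::complex_hilbert \<rightharpoonup> 'h) \<Rightarrow> ('h \<rightharpoonup> 'h)" where
  "adjoint_op X = (\<lambda>\<eta>. if \<exists>\<zeta>. adjoint_rel X \<eta> \<zeta> then Some (THE \<zeta>. adjoint_rel X \<eta> \<zeta>) else None)"

definition closable :: "('h::complex_hilbert \<rightharpoonup> 'h) \<Rightarrow> bool" where
  "closable X \<longleftrightarrow> single_valued (closure (Map.graph X))"

text \<open>The closure of an operator, meaningful for closable \<open>X\<close>.\<close>

definition closure_op :: "('h::complex_hilbert \<rightharpoonup> 'h) \<Rightarrow> ('h \<rightharpoonup> 'h)" where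
  "closure_op X = (\<lambda>\<xi>. if \<exists>\<zeta>. (\<xi>, \<zeta>) \<in> closure (Map.graph X)
     then Some (THE \<zeta>. (\<xi>, \<zeta>) \<in> closure (Map.graph X)) else None)"

text \<open>
  The set \<open>\<L>\<^sup>\<dagger>(\<D>, \<H>)\<close>. Closability is automatic when \<open>D\<close> is dense, since \<open>D \<subseteq> dom (adjoint_op X)\<close>.
\<close>

definition Ldag :: "'h::complex_hilbert set \<Rightarrow> ('h \<rightharpoonup> 'h) set" where
  "Ldag D = {X. linear_operator X \<and> closable X \<and> dom X = D \<and> D \<subseteq> dom (adjoint_op X)}"

definition dag :: "'h::complex_hilbert set \<Rightarrow> ('h \<rightharpoonup> 'h) \<Rightarrow> ('h \<rightharpoonup> 'h)" where
  "dag D X = adjoint_op X |` D"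

definition is_weak_product ::
    "'h::complex_hilbert set \<Rightarrow> ('h \<rightharpoonup> 'h) \<Rightarrow> ('h \<rightharpoonup> 'h) \<Rightarrow> ('h \<rightharpoonup> 'h) \<Rightarrow> bool" where
  "is_weak_product D X1 X2 Z \<longleftrightarrow> Z \<in> Ldag D \<and>
     (\<forall>\<xi>\<in>D. \<forall>\<eta>\<in>D. cinner (the (X2 \<xi>)) (the (dag D X1 \<eta>)) = cinner (the (Z \<xi>)) \<eta>)"

definition Lw :: "'h::complex_hilbert set \<Rightarrow> ('h \<rightharpoonup> 'h) \<Rightarrow> ('h \<rightharpoonup> 'h) set" where
  "Lw D X = {X1 \<in> Ldag D. \<exists>Z. is_weak_product D X1 X Z}"

definition Rw :: "'h::complex_hilbert set \<Rightarrow> ('h \<rightharpoonup> 'h) \<Rightarrow> ('h \<rightharpoonup> 'h) set" where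
  "Rw D X = {X2 \<in> Ldag D. \<exists>Z. is_weak_product D X X2 Z}"

text \<open>The weak product \<open>X1 \<box> X2\<close>; it is unique, when it exists, if \<open>D\<close> is dense.\<close>

definition weak_product ::
    "'h::complex_hilbert set \<Rightarrow> ('h \<rightharpoonup> 'h) \<Rightarrow> ('h \<rightharpoonup> 'h) \<Rightarrow> ('h \<rightharpoonup> 'h)" where
  "weak_product D X1 X2 = (THE Z. is_weak_product D X1 X2 Z)"

definition strong_product_defined ::
    "'h::complex_hilbert set \<Rightarrow> ('h \<rightharpoonup> 'h) \<Rightarrow> ('h \<rightharpoonup> 'h) \<Rightarrow> bool" where
  "strong_product_defined D X Y \<longleftrightarrow>
     (\<forall>\<xi>\<in>D. the (Y \<xi>) \<in> dom (closure_op X)) \<and>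
     (\<forall>\<xi>\<in>D. the (dag D X \<xi>) \<in> dom (closure_op (dag D Y)))"

definition bounded_operator :: "('h::complex_hilbert \<rightharpoonup> 'h) \<Rightarrow> bool" where
  "bounded_operator A \<longleftrightarrow> (\<exists>K. \<forall>\<xi>\<in>dom A. norm (the (A \<xi>)) \<le> K * norm \<xi>)"

definition PP :: "'h::complex_hilbert set \<Rightarrow> ('h \<rightharpoonup> 'h) set" where
  "PP D = {A \<in> Ldag D. bounded_operator A \<and>
     (\<forall>\<xi>\<in>D. the (A \<xi>) \<in> D) \<and> (\<forall>\<xi>\<in>D. the (dag D A \<xi>) \<in> D)}"

definition phi :: "'h::complex_hilbert \<Rightarrow> ('h \<rightharpoonup> 'h) \<Rightarrow> ('h \<rightharpoonup> 'h) \<Rightarrow> complex" where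
  "phi \<xi> S T = cinner (the (S \<xi>)) (the (T \<xi>))"

end

(* The condition indexed by Z says that (Ya, Wa) lies in the graph of X** = closure X for all a in D:
   it suffices to take A, B and Z of rank one, with Z a weak left multiplier of X because its defining
   vector is in the domain of X*. Since V is in R^w(Y) iff V = Z^dag for some Z in L^w(Y^dag), the
   second condition is the first one for Y^dag, X^dag, W^dag. *)

theory Submission
  imports Defs
begin

section \<open>Complex Hilbert spaces\<close>

lemma scaleC_minus_one: "(- 1) *\<^sub>C x = - (x::'a::complex_hilbert)"
  using scaleR_scaleC[of "-1" x] by simp

lemma cinner_add_right: "cinner x (y + z) = cinner x y + cinner x (z::'a::complex_hilbert)"
  by (metis cinner_add_left cinner_commute complex_cnj_add)

lemma cinner_scaleC_right: "cinner x (a *\<^sub>C y) = cnj a * cinner x (y::'a::complex_hilbert)"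
  by (metis cinner_scaleC_left cinner_commute complex_cnj_mult)

lemma cinner_minus_left: "cinner (- x) y = - cinner x (y::'a::complex_hilbert)"
  using cinner_scaleC_left[of "-1" x y] by (simp add: scaleC_minus_one)

lemma cinner_minus_right: "cinner x (- y) = - cinner x (y::'a::complex_hilbert)"
  using cinner_scaleC_right[of x "-1" y] by (simp add: scaleC_minus_one)

lemma cinner_diff_left: "cinner (x - y) z = cinner x z - cinner y (z::'a::complex_hilbert)"
  using cinner_add_left[of x "-y" z] by (simp add: cinner_minus_left)

lemma cinner_diff_right: "cinner x (y - z) = cinner x y - cinner x (z::'a::complex_hilbert)"
  using cinner_add_right[of x y "-z"] by (simp add: cinner_minus_right)

lemma cinner_zero_left [simp]: "cinner 0 (y::'a::complex_hilbert) = 0"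
  using cinner_diff_left[of y y y] by simp

lemma cinner_zero_right [simp]: "cinner (y::'a::complex_hilbert) 0 = 0"
  using cinner_diff_right[of y y y] by simp

lemma cinner_eq_zero_iff: "cinner x x = 0 \<longleftrightarrow> (x::'a::complex_hilbert) = 0"
  by (simp add: cinner_norm)

lemma norm_scaleC: "norm (c *\<^sub>C x) = cmod c * norm (x::'a::complex_hilbert)"
proof -
  have "complex_of_real ((norm (c *\<^sub>C x))\<^sup>2) = complex_of_real ((cmod c * norm x)\<^sup>2)"
    using complex_norm_square[of c] cinner_norm[of x] cinner_norm[of "c *\<^sub>C x"]
    by (simp add: cinner_scaleC_left cinner_scaleC_right power_mult_distrib mult_ac)
  then have "(norm (c *\<^sub>C x))\<^sup>2 = (cmod c * norm x)\<^sup>2"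
    by (simp only: of_real_eq_iff)
  then show ?thesis by simp
qed

text \<open>Pythagoras: subtracting the component along \<open>y\<close> leaves a vector orthogonal
  to \<open>y\<close>. Nonnegativity of the left side yields Cauchy-Schwarz; comparison with a
  minimal distance yields orthogonality.\<close>

lemma norm_diff_projection:
  fixes x y :: "'a::complex_hilbert"
  assumes "y \<noteq> 0"
  shows "(norm (x - (cinner x y / cinner y y) *\<^sub>C y))\<^sup>2 =
    (norm x)\<^sup>2 - (cmod (cinner x y))\<^sup>2 / (norm y)\<^sup>2" (is "(norm ?w)\<^sup>2 = ?r")
proof -
  have "cinner y y \<noteq> 0" using assms by (simp add: cinner_eq_zero_iff)
  then have "cinner ?w y = 0"
    by (simp add: cinner_diff_left cinner_scaleC_left)
  then have "cinner ?w ?w = cinner ?w x"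
    by (simp add: cinner_diff_right cinner_scaleC_right)
  also have "\<dots> = cinner x x - cinner x y * cnj (cinner x y) / cinner y y"
    by (simp add: cinner_diff_left cinner_scaleC_left cinner_commute[of y x])
  also have "\<dots> = complex_of_real ?r"
    by (simp add: cinner_norm complex_norm_square[symmetric])
  finally have "complex_of_real ((norm ?w)\<^sup>2) = complex_of_real ?r"
    by (simp only: cinner_norm)
  then show ?thesis by (simp only: of_real_eq_iff)
qed

lemma norm_cinner_le: "cmod (cinner x y) \<le> norm x * norm (y::'a::complex_hilbert)"
proof (cases "y = 0")
  case False
  have "0 \<le> (norm x)\<^sup>2 - (cmod (cinner x y))\<^sup>2 / (norm y)\<^sup>2"
    using norm_diff_projection[OF False, of x] by (metis zero_le_power2)
  then have "(cmod (cinner x y))\<^sup>2 \<le> (norm x * norm y)\<^sup>2"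
    using False by (simp add: divide_simps power_mult_distrib)
  then show ?thesis by (rule power2_le_imp_le) simp
qed simp

lemma bounded_linear_scaleC: "bounded_linear (\<lambda>x::'a::complex_hilbert. c *\<^sub>C x)"
  by (rule bounded_linear_intro[where K = "cmod c"])
    (simp_all add: scaleC_add_right scaleR_scaleC complex_vector.scale_left_commute norm_scaleC)

lemma bounded_linear_cinner_left: "bounded_linear (\<lambda>x::'a::complex_hilbert. cinner x y)"
  by (rule bounded_linear_intro[where K = "norm y"])
    (simp_all add: cinner_add_left scaleR_scaleC[where 'a='a] cinner_scaleC_left norm_cinner_le
      scaleR_conv_of_real)

lemma bounded_linear_cinner_right: "bounded_linear (\<lambda>y::'a::complex_hilbert. cinner x y)"
  by (rule bounded_linear_intro[where K = "norm x"])
    (simp_all add: cinner_add_right scaleR_scaleC[where 'a='a] cinner_scaleC_right norm_cinner_le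
      scaleR_conv_of_real, metis norm_cinner_le mult.commute)

lemmas tendsto_cinner_left = bounded_linear.tendsto[OF bounded_linear_cinner_left]
lemmas tendsto_cinner_right = bounded_linear.tendsto[OF bounded_linear_cinner_right]

text \<open>The difference \<open>x - y\<close> is orthogonal to \<open>D\<close> and, being a limit
  of points of \<open>D\<close>, also to itself.\<close>

lemma cinner_eqI_dense:
  fixes x y :: "'a::complex_hilbert"
  assumes "closure D = UNIV" and "\<And>\<eta>. \<eta> \<in> D \<Longrightarrow> cinner x \<eta> = cinner y \<eta>"
  shows "x = y"
proof -
  obtain f where f: "\<And>n. f n \<in> D" "f \<longlonglongrightarrow> x - y"
    using assms(1) closure_sequential[of "x - y" D] by auto
  have "(\<lambda>n. cinner (x - y) (f n)) \<longlonglongrightarrow> cinner (x - y) (x - y)"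
    by (rule tendsto_cinner_right[OF f(2)])
  moreover have "cinner (x - y) (f n) = 0" for n
    using assms(2)[OF f(1)] by (simp add: cinner_diff_left)
  ultimately have "cinner (x - y) (x - y) = 0" by (simp add: LIMSEQ_const_iff)
  then show ?thesis by (simp add: cinner_eq_zero_iff)
qed

lemma subspace_closure:
  fixes S :: "'a::complex_hilbert set"
  assumes "complex_vector.subspace S"
  shows "complex_vector.subspace (closure S)"
proof (rule complex_vector.subspaceI)
  show "0 \<in> closure S"
    using complex_vector.subspace_0[OF assms] closure_subset by blast
next
  fix x y assume "x \<in> closure S" "y \<in> closure S"
  then obtain f g where "\<And>n. f n \<in> S" "f \<longlonglongrightarrow> x" "\<And>n. g n \<in> S" "g \<longlonglongrightarrow> y"
    by (auto simp: closure_sequential)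
  then show "x + y \<in> closure S"
    unfolding closure_sequential
    by (intro exI[of _ "\<lambda>n. f n + g n"])
      (auto intro: tendsto_add complex_vector.subspace_add[OF assms])
next
  fix c x assume "x \<in> closure S"
  then obtain f where "\<And>n. f n \<in> S" "f \<longlonglongrightarrow> x"
    by (auto simp: closure_sequential)
  then show "c *\<^sub>C x \<in> closure S"
    unfolding closure_sequential
    by (intro exI[of _ "\<lambda>n. c *\<^sub>C f n"])
      (auto intro: bounded_linear.tendsto[OF bounded_linear_scaleC]
        complex_vector.subspace_scale[OF assms])
qed

section \<open>Orthogonal separation from a closed subspace\<close>

lemma parallelogram_law:
  fixes x y :: "'a::complex_hilbert"
  shows "(norm (x + y))\<^sup>2 + (norm (x - y))\<^sup>2 = 2 * (norm x)\<^sup>2 + 2 * (norm y)\<^sup>2"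
proof -
  have "cinner (x + y) (x + y) + cinner (x - y) (x - y) = 2 * cinner x x + 2 * cinner y y"
    by (simp add: cinner_add_left cinner_add_right cinner_diff_left cinner_diff_right)
  then have "complex_of_real ((norm (x + y))\<^sup>2 + (norm (x - y))\<^sup>2) =
      complex_of_real (2 * (norm x)\<^sup>2 + 2 * (norm y)\<^sup>2)"
    by (simp add: cinner_norm)
  then show ?thesis by (simp only: of_real_eq_iff)
qed

text \<open>A minimizing sequence in \<open>C\<close> is Cauchy by the parallelogram law;
  completeness of the space and closedness of \<open>C\<close> supply its limit.\<close>

lemma closest_point_subspace:
  fixes C :: "'a::complex_hilbert set"
  assumes C: "closed C" "complex_vector.subspace C"
  obtains y where "y \<in> C" "\<And>z. z \<in> C \<Longrightarrow> norm (x - y) \<le> norm (x - z)"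
proof -
  define d where "d = (INF z\<in>C. norm (x - z))"
  have ne: "C \<noteq> {}" using complex_vector.subspace_0[OF C(2)] by auto
  have bdd: "bdd_below ((\<lambda>z. norm (x - z)) ` C)" by (auto intro: bdd_belowI[of _ 0])
  have lower: "d \<le> norm (x - z)" if "z \<in> C" for z
    unfolding d_def by (rule cINF_lower[OF bdd that])
  have d0: "0 \<le> d" unfolding d_def by (rule cINF_greatest[OF ne]) simp
  have "\<exists>z\<in>C. norm (x - z) < d + 1 / real (Suc n)" for n
  proof -
    have "d < d + 1 / real (Suc n)" by simp
    then show ?thesis
      unfolding d_def by (subst (asm) cINF_less_iff[OF ne bdd]) auto
  qed
  then obtain f where f: "\<And>n. f n \<in> C" "\<And>n. norm (x - f n) < d + 1 / real (Suc n)" by metis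
  have lim: "(\<lambda>n. norm (x - f n)) \<longlonglongrightarrow> d"
  proof (rule tendsto_sandwich[of "\<lambda>_. d" _ _ "\<lambda>n. d + 1 / real (Suc n)"])
    show "(\<lambda>n. d + 1 / real (Suc n)) \<longlonglongrightarrow> d"
      using tendsto_add[OF tendsto_const[of d] LIMSEQ_inverse_real_of_nat]
      by (simp add: inverse_eq_divide)
  qed (auto intro!: always_eventually lower f(1) less_imp_le[OF f(2)] simp del: of_nat_Suc)
  \<comment> \<open>The midpoint of two points of \<open>C\<close> is in \<open>C\<close>, hence at distance at least \<open>d\<close> from \<open>x\<close>.\<close>
  have par: "(norm (f m - f n))\<^sup>2 \<le> 2 * (norm (x - f m))\<^sup>2 + 2 * (norm (x - f n))\<^sup>2 - 4 * d\<^sup>2" for m n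
  proof -
    have "(1/2) *\<^sub>R (f m + f n) \<in> C"
      using f(1) C(2) by (simp only: scaleR_scaleC complex_vector.subspace_add complex_vector.subspace_scale)
    then have "d \<le> norm (x - (1/2) *\<^sub>R (f m + f n))" by (rule lower)
    moreover have "(x - f m) + (x - f n) = 2 *\<^sub>R (x - (1/2) *\<^sub>R (f m + f n))"
      by (simp add: algebra_simps scaleR_2)
    ultimately have "2 * d \<le> norm ((x - f m) + (x - f n))" by simp
    then have "(2 * d)\<^sup>2 \<le> (norm ((x - f m) + (x - f n)))\<^sup>2" using d0 by (intro power_mono) auto
    then show ?thesis
      using parallelogram_law[of "x - f m" "x - f n"] by (simp add: norm_minus_commute)
  qed
  have "Cauchy f"
  proof (rule metric_CauchyI)
    fix e :: real assume e: "e > 0"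
    \<comment> \<open>By \<open>par\<close>, the squared distance of \<open>f m\<close> and
      \<open>f n\<close> is at most the sum of this expression at \<open>m\<close> and at
      \<open>n\<close>.\<close>
    have "(\<lambda>n. 2 * (norm (x - f n))\<^sup>2 - 2 * d\<^sup>2) \<longlonglongrightarrow> 2 * d\<^sup>2 - 2 * d\<^sup>2"
      by (intro tendsto_intros lim)
    then have "\<forall>\<^sub>F n in sequentially. 2 * (norm (x - f n))\<^sup>2 - 2 * d\<^sup>2 < e\<^sup>2 / 2"
      using e by (intro order_tendstoD) auto
    then obtain N where N: "\<And>n. n \<ge> N \<Longrightarrow> 2 * (norm (x - f n))\<^sup>2 - 2 * d\<^sup>2 < e\<^sup>2 / 2"
      by (auto simp: eventually_sequentially)
    show "\<exists>M. \<forall>m\<ge>M. \<forall>n\<ge>M. dist (f m) (f n) < e"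
    proof (intro exI allI impI)
      fix m n assume "m \<ge> N" "n \<ge> N"
      then have "(norm (f m - f n))\<^sup>2 < e\<^sup>2" using par[of m n] N[of m] N[of n] by linarith
      then show "dist (f m) (f n) < e" using e by (simp add: dist_norm power2_less_imp_less)
    qed
  qed
  then obtain y where y: "f \<longlonglongrightarrow> y" by (metis Cauchy_convergent convergent_def)
  have "y \<in> C" using C(1) f(1) y by (metis closed_sequential_limits)
  moreover have "norm (x - y) = d"
    using LIMSEQ_unique[OF lim, of "norm (x - y)"] tendsto_norm[OF tendsto_diff[OF tendsto_const y]]
    by simp
  ultimately show ?thesis using lower that by metis
qed

text \<open>The separating vector is the residual of \<open>x\<close> at its closest point
  \<open>y\<close> in \<open>C\<close>.\<close>

lemma exists_orthogonal_separating:
  fixes C :: "'a::complex_hilbert set"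
  assumes C: "closed C" "complex_vector.subspace C" and "x \<notin> C"
  obtains w where "\<And>v. v \<in> C \<Longrightarrow> cinner v w = 0" "cinner x w \<noteq> 0"
proof -
  obtain y where y: "y \<in> C" "\<And>z. z \<in> C \<Longrightarrow> norm (x - y) \<le> norm (x - z)"
    using closest_point_subspace[OF C, of x] by metis
  define w where "w = x - y"
  have orth: "cinner w v = 0" if "v \<in> C" for v
  proof (cases "v = 0")
    case False
    \<comment> \<open>This competitor for \<open>y\<close> would be strictly closer to
      \<open>x\<close> if \<open>cinner w v\<close> were nonzero.\<close>
    have "y + (cinner w v / cinner v v) *\<^sub>C v \<in> C"
      using y(1) that C(2) complex_vector.subspace_add complex_vector.subspace_scale by metis
    from y(2)[OF this] have "(norm w)\<^sup>2 \<le> (norm (w - (cinner w v / cinner v v) *\<^sub>C v))\<^sup>2"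
      unfolding w_def by (simp add: diff_diff_eq power_mono)
    with norm_diff_projection[OF False, of w] have "(cmod (cinner w v))\<^sup>2 / (norm v)\<^sup>2 \<le> 0" by simp
    then show ?thesis using False by (simp add: divide_simps)
  qed simp
  have orth': "cinner v w = 0" if "v \<in> C" for v
    using orth[OF that] cinner_commute[of v w] by simp
  have "cinner x w = cinner w w + cinner y w" by (simp add: w_def cinner_diff_left)
  then have "cinner x w \<noteq> 0" using orth'[OF y(1)] assms(3) y(1) by (auto simp: cinner_eq_zero_iff w_def)
  with orth' show ?thesis by (rule that)
qed

section \<open>Graphs as subspaces of the product Hilbert space, and the double adjoint\<close>

instantiation prod :: (complex_hilbert, complex_hilbert) complex_hilbert
begin

definition "c *\<^sub>C p = (c *\<^sub>C fst p, c *\<^sub>C snd p)"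
definition "cinner p q = cinner (fst p) (fst q) + cinner (snd p) (snd q)"

instance
proof
  fix p q :: "'a \<times> 'b"
  show "cinner p q = cnj (cinner q p)"
    by (simp add: cinner_prod_def cinner_commute[of "fst p"] cinner_commute[of "snd p"])
qed (auto simp: scaleC_prod_def cinner_prod_def scaleC_add_right scaleC_add_left scaleC_scaleC
    scaleR_prod_def scaleR_scaleC cinner_add_left cinner_scaleC_left distrib_left cinner_norm norm_prod_def)

end

section \<open>Operators on a dense domain\<close>

text \<open>The adjoint identity holds on the graph and passes to limits by continuity. This is the
  inclusion of the closure of \<open>X\<close> in its double adjoint.\<close>

lemma closure_graph_adjoint:
  assumes "(x, y) \<in> closure (Map.graph X)" and "adjoint_rel X \<eta> \<zeta>"
  shows "cinner y \<eta> = cinner x \<zeta>"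
proof -
  obtain f where f: "\<And>n. f n \<in> Map.graph X" "f \<longlonglongrightarrow> (x, y)"
    using assms(1) by (auto simp: closure_sequential)
  have "cinner (snd (f n)) \<eta> = cinner (fst (f n)) \<zeta>" for n
    using f(1)[of n] assms(2) by (force simp: Map.graph_def adjoint_rel_def dom_def)
  moreover have "(\<lambda>n. cinner (snd (f n)) \<eta>) \<longlonglongrightarrow> cinner y \<eta>"
    using tendsto_cinner_left[OF tendsto_snd[OF f(2)]] by simp
  moreover have "(\<lambda>n. cinner (fst (f n)) \<zeta>) \<longlonglongrightarrow> cinner x \<zeta>"
    using tendsto_cinner_left[OF tendsto_fst[OF f(2)]] by simp
  ultimately show ?thesis by (metis (no_types, lifting) LIMSEQ_unique ext)
qed

lemma subspace_graph:
  assumes "linear_operator X"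
  shows "complex_vector.subspace (Map.graph X)"
proof -
  have dom: "complex_vector.subspace (dom X)"
    and add: "\<And>x y. x \<in> dom X \<Longrightarrow> y \<in> dom X \<Longrightarrow> the (X (x + y)) = the (X x) + the (X y)"
    and scale: "\<And>c x. x \<in> dom X \<Longrightarrow> the (X (c *\<^sub>C x)) = c *\<^sub>C the (X x)"
    using assms unfolding linear_operator_def by auto
  have mem: "(x, y) \<in> Map.graph X \<longleftrightarrow> x \<in> dom X \<and> y = the (X x)" for x y
    by (auto simp: Map.graph_def)
  show ?thesis
  proof (rule complex_vector.subspaceI)
    have "the (X 0) = 0"
      using scale[of 0 0] complex_vector.subspace_0[OF dom] by simp
    then show "0 \<in> Map.graph X"
      using complex_vector.subspace_0[OF dom] by (simp add: zero_prod_def mem)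
  next
    fix p q assume "p \<in> Map.graph X" "q \<in> Map.graph X"
    then show "p + q \<in> Map.graph X"
      by (cases p; cases q) (simp add: mem add complex_vector.subspace_add[OF dom])
  next
    fix c p assume "p \<in> Map.graph X"
    then show "c *\<^sub>C p \<in> Map.graph X"
      by (cases p) (simp add: mem scaleC_prod_def scale complex_vector.subspace_scale[OF dom])
  qed
qed

text \<open>A vector \<open>(u, v)\<close> orthogonal to the graph of \<open>X\<close> satisfies
  \<open>X\<^sup>* v = - u\<close>.\<close>

lemma closure_graph_biadjoint:
  assumes "linear_operator X"
    and "\<And>\<eta> \<zeta>. adjoint_rel X \<eta> \<zeta> \<Longrightarrow> cinner y \<eta> = cinner x \<zeta>"
  shows "(x, y) \<in> closure (Map.graph X)"
proof (rule ccontr)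
  assume "(x, y) \<notin> closure (Map.graph X)"
  then obtain w where w: "\<And>p. p \<in> closure (Map.graph X) \<Longrightarrow> cinner p w = 0" "cinner (x, y) w \<noteq> 0"
    using exists_orthogonal_separating[OF closed_closure subspace_closure[OF subspace_graph[OF assms(1)]]]
    by metis
  have "adjoint_rel X (snd w) (- fst w)"
    unfolding adjoint_rel_def
  proof
    fix \<xi> assume "\<xi> \<in> dom X"
    then have "(\<xi>, the (X \<xi>)) \<in> closure (Map.graph X)"
      by (intro subsetD[OF closure_subset]) (auto simp: Map.graph_def)
    from w(1)[OF this] show "cinner (the (X \<xi>)) (snd w) = cinner \<xi> (- fst w)"
      by (simp add: cinner_prod_def cinner_minus_right add_eq_0_iff)
  qed
  from assms(2)[OF this] w(2) show False
    by (simp add: cinner_prod_def cinner_minus_right)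
qed

lemma dom_closure_op: "x \<in> dom (closure_op X) \<longleftrightarrow> (\<exists>y. (x, y) \<in> closure (Map.graph X))"
  by (auto simp: closure_op_def dom_def)

definition op_on :: "'h set \<Rightarrow> ('h \<Rightarrow> 'h) \<Rightarrow> ('h \<rightharpoonup> 'h)" where
  "op_on D f = (\<lambda>\<xi>. if \<xi> \<in> D then Some (f \<xi>) else None)"

lemma dom_op_on [simp]: "dom (op_on D f) = D"
  by (auto simp: op_on_def split: if_splits)

lemma op_on_apply [simp]: "\<xi> \<in> D \<Longrightarrow> op_on D f \<xi> = Some (f \<xi>)"
  by (simp add: op_on_def)

lemma op_on_the: "dom X = D \<Longrightarrow> op_on D (\<lambda>\<xi>. the (X \<xi>)) = X"
  by (auto simp: op_on_def fun_eq_iff domIff)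

section \<open>Operators with a common dense domain and their adjoints\<close>

locale dense_subspace =
  fixes D :: "'h::complex_hilbert set"
  assumes subspace: "complex_vector.subspace D" and dense: "closure D = UNIV"
begin

lemma eqI_left: "(\<And>\<eta>. \<eta> \<in> D \<Longrightarrow> cinner x \<eta> = cinner y \<eta>) \<Longrightarrow> x = y"
  by (rule cinner_eqI_dense[OF dense])

lemma eqI_right: "(\<And>\<xi>. \<xi> \<in> D \<Longrightarrow> cinner \<xi> x = cinner \<xi> y) \<Longrightarrow> x = y"
  by (rule eqI_left) (metis cinner_commute)

lemma adjoint_rel_unique:
  "dom X = D \<Longrightarrow> adjoint_rel X \<eta> \<zeta> \<Longrightarrow> adjoint_rel X \<eta> \<zeta>' \<Longrightarrow> \<zeta> = \<zeta>'"
  by (rule eqI_right) (simp add: adjoint_rel_def)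

lemma adjoint_op_eq: "dom X = D \<Longrightarrow> adjoint_rel X \<eta> \<zeta> \<Longrightarrow> adjoint_op X \<eta> = Some \<zeta>"
  unfolding adjoint_op_def using the_equality[of "adjoint_rel X \<eta>" \<zeta>] adjoint_rel_unique by metis

text \<open>A formal adjoint \<open>g\<close> on \<open>D\<close> forces everything else: linearity
  and closability of \<open>f\<close> follow by testing against the dense set
  \<open>D\<close>.\<close>

lemma op_on_Ldag:
  assumes adj: "\<And>\<xi> \<eta>. \<xi> \<in> D \<Longrightarrow> \<eta> \<in> D \<Longrightarrow> cinner (f \<xi>) \<eta> = cinner \<xi> (g \<eta>)"
  shows "op_on D f \<in> Ldag D" and "dag D (op_on D f) = op_on D g"
proof -
  have rel: "adjoint_rel (op_on D f) \<eta> (g \<eta>)" if "\<eta> \<in> D" for \<eta>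
    using adj that by (simp add: adjoint_rel_def)
  have op: "adjoint_op (op_on D f) \<eta> = Some (g \<eta>)" if "\<eta> \<in> D" for \<eta>
    using rel[OF that] by (simp add: adjoint_op_eq)
  then show "dag D (op_on D f) = op_on D g"
    by (auto simp: dag_def op_on_def restrict_map_def fun_eq_iff)
  have "f (\<xi> + \<xi>') = f \<xi> + f \<xi>'" if "\<xi> \<in> D" "\<xi>' \<in> D" for \<xi> \<xi>'
    using that by (intro eqI_left) (simp add: adj cinner_add_left complex_vector.subspace_add[OF subspace])
  moreover have "f (c *\<^sub>C \<xi>) = c *\<^sub>C f \<xi>" if "\<xi> \<in> D" for c \<xi>
    using that by (intro eqI_left) (simp add: adj cinner_scaleC_left complex_vector.subspace_scale[OF subspace])
  ultimately have "linear_operator (op_on D f)"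
    by (simp add: linear_operator_def subspace complex_vector.subspace_add[OF subspace]
        complex_vector.subspace_scale[OF subspace])
  moreover have "closable (op_on D f)"
    unfolding closable_def single_valued_def
  proof (intro allI impI)
    fix x y z
    assume "(x, y) \<in> closure (Map.graph (op_on D f))" "(x, z) \<in> closure (Map.graph (op_on D f))"
    then show "y = z" by (intro eqI_left) (metis closure_graph_adjoint rel)
  qed
  ultimately show "op_on D f \<in> Ldag D"
    using op by (auto simp: Ldag_def)
qed

lemma dom_Ldag: "X \<in> Ldag D \<Longrightarrow> dom X = D"
  by (simp add: Ldag_def)

lemma Ldag_adjoint_rel:
  assumes "X \<in> Ldag D" "\<eta> \<in> D"
  shows "adjoint_rel X \<eta> (the (dag D X \<eta>))"
proof -
  obtain \<zeta> where "adjoint_rel X \<eta> \<zeta>"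
    using assms by (auto simp: Ldag_def adjoint_op_def dom_def split: if_splits)
  then show ?thesis
    using adjoint_op_eq[OF dom_Ldag[OF assms(1)]] assms(2) by (simp add: dag_def)
qed

lemma Ldag_adjoint:
  "X \<in> Ldag D \<Longrightarrow> \<xi> \<in> D \<Longrightarrow> \<eta> \<in> D \<Longrightarrow> cinner (the (X \<xi>)) \<eta> = cinner \<xi> (the (dag D X \<eta>))"
  using Ldag_adjoint_rel by (simp add: adjoint_rel_def dom_Ldag)

lemma Ldag_adjoint':
  "X \<in> Ldag D \<Longrightarrow> \<xi> \<in> D \<Longrightarrow> \<eta> \<in> D \<Longrightarrow> cinner (the (dag D X \<xi>)) \<eta> = cinner \<xi> (the (X \<eta>))"
  by (metis Ldag_adjoint cinner_commute)

text \<open>Formal adjointness is symmetric, so \<open>op_on_Ldag\<close> also applies with the two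
  functions exchanged.\<close>

lemma dag_Ldag: "X \<in> Ldag D \<Longrightarrow> dag D X \<in> Ldag D"
  and dag_dag: "X \<in> Ldag D \<Longrightarrow> dag D (dag D X) = X"
proof -
  assume X: "X \<in> Ldag D"
  have "dag D X = op_on D (\<lambda>\<xi>. the (dag D X \<xi>))"
    using op_on_Ldag(2)[OF Ldag_adjoint[OF X]] op_on_the[OF dom_Ldag[OF X]] by simp
  with op_on_Ldag[OF Ldag_adjoint'[OF X]] op_on_the[OF dom_Ldag[OF X]]
  show "dag D X \<in> Ldag D" "dag D (dag D X) = X" by simp_all
qed

lemma Ldag_zero:
  assumes "X \<in> Ldag D"
  shows "the (X 0) = 0"
proof (rule eqI_left)
  fix \<eta> assume "\<eta> \<in> D"
  then show "cinner (the (X 0)) \<eta> = cinner 0 \<eta>"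
    using Ldag_adjoint[OF assms complex_vector.subspace_0[OF subspace]] by simp
qed

section \<open>Weak products, and composition with elements of \<open>PP D\<close>\<close>

lemma weak_product_eq:
  assumes "is_weak_product D X1 X2 Z"
  shows "weak_product D X1 X2 = Z"
  unfolding weak_product_def
proof (rule the_equality)
  show "is_weak_product D X1 X2 Z" by (rule assms)
  fix Z' assume Z': "is_weak_product D X1 X2 Z'"
  have "the (Z' \<xi>) = the (Z \<xi>)" if "\<xi> \<in> D" for \<xi>
    using assms Z' that by (intro eqI_left) (metis is_weak_product_def)
  moreover have "dom Z' = D" "dom Z = D"
    using assms Z' by (simp_all add: is_weak_product_def dom_Ldag)
  ultimately show "Z' = Z"
    by (metis map_le_antisym map_le_def domD option.sel)
qed

text \<open>The operator \<open>dag D A\<close> inherits a bound from \<open>A\<close>, so it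
  extends by continuity from \<open>D\<close> to all vectors. The extension satisfies the adjoint
  identity in the limit.\<close>

lemma PP_adjoint_total:
  assumes "A \<in> PP D"
  shows "\<exists>\<zeta>. adjoint_rel A \<eta> \<zeta>"
proof -
  have A: "A \<in> Ldag D" and range: "\<And>\<xi>. \<xi> \<in> D \<Longrightarrow> the (dag D A \<xi>) \<in> D"
    using assms by (auto simp: PP_def)
  obtain K where "\<And>\<xi>. \<xi> \<in> D \<Longrightarrow> norm (the (A \<xi>)) \<le> K * norm \<xi>"
    using assms by (auto simp: PP_def bounded_operator_def dom_Ldag[OF A])
  \<comment> \<open>The absolute value makes the bound nonnegative, so that it can be enlarged to
    \<open>\<bar>K\<bar> + 1\<close> and divided by below.\<close>
  then have K: "norm (the (A \<xi>)) \<le> \<bar>K\<bar> * norm \<xi>" if "\<xi> \<in> D" for \<xi>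
    using that by (meson abs_ge_self mult_right_mono norm_ge_zero order_trans)
  have bound: "norm (the (dag D A \<xi>)) \<le> \<bar>K\<bar> * norm \<xi>" if "\<xi> \<in> D" for \<xi>
  proof -
    let ?u = "the (dag D A \<xi>)"
    have "(norm ?u)\<^sup>2 = cmod (cinner ?u ?u)" by (simp add: cinner_norm norm_power)
    \<comment> \<open>Here \<open>A\<close> is applied to \<open>?u\<close>, which is possible
      because \<open>dag D A\<close> maps \<open>D\<close> into itself.\<close>
    also have "\<dots> = cmod (cinner (the (A ?u)) \<xi>)"
      using Ldag_adjoint[OF A range[OF that] that] by simp
    also have "\<dots> \<le> norm (the (A ?u)) * norm \<xi>" by (rule norm_cinner_le)
    also have "\<dots> \<le> \<bar>K\<bar> * norm ?u * norm \<xi>" by (intro mult_right_mono K range that norm_ge_zero)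
    finally have "norm ?u * norm ?u \<le> norm ?u * (\<bar>K\<bar> * norm \<xi>)" by (simp add: power2_eq_square mult_ac)
    then show ?thesis by (cases "norm ?u = 0") (auto simp: mult_le_cancel_left)
  qed
  obtain f where f: "\<And>n. f n \<in> D" "f \<longlonglongrightarrow> \<eta>"
    using dense closure_sequential[of \<eta> D] by auto
  define g where "g n = the (dag D A (f n))" for n
  have diff: "norm (g m - g n) \<le> \<bar>K\<bar> * norm (f m - f n)" for m n
  proof -
    have mem: "f m - f n \<in> D" by (simp add: f(1) complex_vector.subspace_diff[OF subspace])
    have "the (dag D A (f m - f n)) = g m - g n"
      by (rule eqI_left) (simp add: Ldag_adjoint'[OF A] mem f(1) g_def cinner_diff_left)
    then show ?thesis using bound[OF mem] by simp
  qed
  have "Cauchy g"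
  proof (rule metric_CauchyI)
    fix e :: real assume "e > 0"
    then have "e / (\<bar>K\<bar> + 1) > 0" by simp
    then obtain M where M: "\<And>m n. m \<ge> M \<Longrightarrow> n \<ge> M \<Longrightarrow> dist (f m) (f n) < e / (\<bar>K\<bar> + 1)"
      using metric_CauchyD[OF LIMSEQ_imp_Cauchy[OF f(2)]] by metis
    have "dist (g m) (g n) < e" if "m \<ge> M" "n \<ge> M" for m n
    proof -
      have "norm (g m - g n) \<le> (\<bar>K\<bar> + 1) * norm (f m - f n)"
        using diff[of m n] by (simp add: distrib_right add_increasing2)
      also have "\<dots> < e" using M[OF that] by (simp add: dist_norm field_simps)
      finally show ?thesis by (simp add: dist_norm)
    qed
    then show "\<exists>M. \<forall>m\<ge>M. \<forall>n\<ge>M. dist (g m) (g n) < e" by blast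
  qed
  then obtain \<zeta> where \<zeta>: "g \<longlonglongrightarrow> \<zeta>" by (metis Cauchy_convergent convergent_def)
  have "cinner (the (A \<xi>)) \<eta> = cinner \<xi> \<zeta>" if "\<xi> \<in> D" for \<xi>
  proof (rule LIMSEQ_unique)
    show "(\<lambda>n. cinner (the (A \<xi>)) (f n)) \<longlonglongrightarrow> cinner (the (A \<xi>)) \<eta>"
      by (rule tendsto_cinner_right[OF f(2)])
    show "(\<lambda>n. cinner (the (A \<xi>)) (f n)) \<longlonglongrightarrow> cinner \<xi> \<zeta>"
      using tendsto_cinner_right[OF \<zeta>] by (simp add: Ldag_adjoint[OF A that f(1)] g_def)
  qed
  then show ?thesis by (auto simp: adjoint_rel_def dom_Ldag[OF A])
qed

text \<open>The composition has a formal adjoint: first \<open>dag D T\<close>, then the adjoint of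
  \<open>A\<close>. Since \<open>dag D T\<close> may lead out of \<open>D\<close>, the adjoint of
  \<open>A\<close> must be available on the whole space, which is what
  \<open>PP_adjoint_total\<close> provides.\<close>

lemma weak_product_PP:
  assumes T: "T \<in> Ldag D" and A: "A \<in> PP D" and "\<xi> \<in> D"
  shows "the (weak_product D T A \<xi>) = the (T (the (A \<xi>)))"
proof -
  have AL: "A \<in> Ldag D" and range: "\<And>\<xi>. \<xi> \<in> D \<Longrightarrow> the (A \<xi>) \<in> D"
    using A by (auto simp: PP_def)
  obtain g where g: "\<And>\<eta>. adjoint_rel A \<eta> (g \<eta>)"
    using PP_adjoint_total[OF A] by metis
  let ?f = "\<lambda>\<xi>. the (T (the (A \<xi>)))"
  have "op_on D ?f \<in> Ldag D"
  proof (rule op_on_Ldag(1))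
    fix \<xi> \<eta> assume "\<xi> \<in> D" "\<eta> \<in> D"
    then show "cinner (?f \<xi>) \<eta> = cinner \<xi> (g (the (dag D T \<eta>)))"
      using g[of "the (dag D T \<eta>)"] by (simp add: Ldag_adjoint[OF T] range adjoint_rel_def dom_Ldag[OF AL])
  qed
  then have "is_weak_product D T A (op_on D ?f)"
    by (simp add: is_weak_product_def Ldag_adjoint[OF T] range)
  from weak_product_eq[OF this] show ?thesis using assms(3) by simp
qed

section \<open>Rank-one operators as test multipliers\<close>

definition rank_one :: "'h \<Rightarrow> 'h \<Rightarrow> ('h \<rightharpoonup> 'h)" where
  "rank_one a b = op_on D (\<lambda>u. cinner u b *\<^sub>C a)"

lemma rank_one_apply [simp]: "u \<in> D \<Longrightarrow> rank_one a b u = Some (cinner u b *\<^sub>C a)"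
  by (simp add: rank_one_def)

text \<open>Exchanging the two vectors gives a formal adjoint. They are arbitrary vectors of the
  space, so that one of them can later range over the domain of \<open>adjoint_op X\<close>.\<close>

lemma rank_one_Ldag: "rank_one a b \<in> Ldag D"
  and dag_rank_one: "dag D (rank_one a b) = rank_one b a"
proof -
  have "cinner (cinner u b *\<^sub>C a) v = cinner u (cinner v a *\<^sub>C b)" for u v
    by (simp add: cinner_scaleC_left cinner_scaleC_right cinner_commute[of a v])
  from op_on_Ldag[OF this] show "rank_one a b \<in> Ldag D" "dag D (rank_one a b) = rank_one b a"
    by (simp_all add: rank_one_def)
qed

lemma rank_one_PP:
  assumes "a \<in> D" "b \<in> D"
  shows "rank_one a b \<in> PP D"
proof -
  have "norm (cinner u b *\<^sub>C a) \<le> (norm b * norm a) * norm u" for u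
    using mult_right_mono[OF norm_cinner_le[of u b] norm_ge_zero[of a]] by (simp add: norm_scaleC mult_ac)
  then have "bounded_operator (rank_one a b)"
    unfolding bounded_operator_def dom_Ldag[OF rank_one_Ldag]
    by (intro exI[of _ "norm b * norm a"]) simp
  then show ?thesis
    using assms by (simp add: PP_def rank_one_Ldag dag_rank_one complex_vector.subspace_scale[OF subspace])
qed

text \<open>The set \<open>PP D\<close> moves any nonzero vector of \<open>D\<close> to any vector
  of \<open>D\<close>; the scalar \<open>?c\<close> normalizes the rank-one operator.\<close>

lemma exists_PP_mapping:
  assumes "\<xi> \<in> D" "\<xi> \<noteq> 0" "a \<in> D"
  obtains A where "A \<in> PP D" "the (A \<xi>) = a"
proof
  let ?c = "1 / cinner \<xi> \<xi>"
  show "rank_one (?c *\<^sub>C a) \<xi> \<in> PP D"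
    using assms by (intro rank_one_PP complex_vector.subspace_scale[OF subspace])
  show "the (rank_one (?c *\<^sub>C a) \<xi> \<xi>) = a"
    using assms by (simp add: scaleC_scaleC cinner_eq_zero_iff)
qed

section \<open>Strong products\<close>

text \<open>Products with \<open>A\<close> and \<open>B\<close> are compositions, so the values
  involved are those at \<open>A \<xi>\<close> and \<open>B \<xi>\<close>. By
  \<open>exists_PP_mapping\<close> these two vectors can be prescribed independently, which
  eliminates \<open>\<xi>\<close>, \<open>A\<close> and \<open>B\<close>.\<close>

lemma phi_PP_eq_iff:
  assumes "S \<in> Ldag D" "T \<in> Ldag D" "S' \<in> Ldag D" "T' \<in> Ldag D"
  shows "(\<forall>\<xi>\<in>D. \<forall>A\<in>PP D. \<forall>B\<in>PP D.
      phi \<xi> (weak_product D S A) (weak_product D T B) = phi \<xi> (weak_product D S' A) (weak_product D T' B)) \<longleftrightarrow>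
    (\<forall>a\<in>D. \<forall>b\<in>D. cinner (the (S a)) (the (T b)) = cinner (the (S' a)) (the (T' b)))" (is "?l \<longleftrightarrow> ?r")
proof
  assume ?r
  moreover have "the (A \<xi>) \<in> D" if "A \<in> PP D" "\<xi> \<in> D" for A \<xi>
    using that by (simp add: PP_def)
  ultimately show ?l by (simp add: phi_def weak_product_PP assms)
next
  assume l: ?l
  show ?r
  proof (intro ballI)
    fix a b assume ab: "a \<in> D" "b \<in> D"
    show "cinner (the (S a)) (the (T b)) = cinner (the (S' a)) (the (T' b))"
    \<comment> \<open>A nonzero \<open>a\<close> serves as \<open>\<xi>\<close> itself, with
      \<open>A\<close> fixing it and \<open>B\<close> sending it to \<open>b\<close>; for
      \<open>a = 0\<close> both sides vanish.\<close>
    proof (cases "a = 0")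
      case False
      obtain A where A: "A \<in> PP D" "the (A a) = a" using exists_PP_mapping[OF ab(1) False ab(1)] .
      obtain B where B: "B \<in> PP D" "the (B a) = b" using exists_PP_mapping[OF ab(1) False ab(2)] .
      from l A(1) B(1) ab(1) show ?thesis
        by (simp add: phi_def weak_product_PP assms) (metis A B)
    qed (simp add: Ldag_zero assms)
  qed
qed

text \<open>Conjugating the defining identity of the weak product reverses the factors.\<close>

lemma weak_product_dag:
  assumes "X \<in> Ldag D" "is_weak_product D Z X P"
  shows "is_weak_product D (dag D X) (dag D Z) (dag D P)"
proof -
  have P: "P \<in> Ldag D" using assms(2) by (simp add: is_weak_product_def)
  have "cinner (the (dag D Z \<xi>)) (the (X \<eta>)) = cinner (the (dag D P \<xi>)) \<eta>" if "\<xi> \<in> D" "\<eta> \<in> D" for \<xi> \<eta>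
  proof -
    have "cinner (the (X \<eta>)) (the (dag D Z \<xi>)) = cinner (the (P \<eta>)) \<xi>"
      using assms(2) that by (simp add: is_weak_product_def)
    then show ?thesis
      by (metis cinner_commute Ldag_adjoint[OF P] that)
  qed
  then show ?thesis by (simp add: is_weak_product_def dag_Ldag[OF P] dag_dag[OF assms(1)])
qed

text \<open>Read with \<open>b\<close> fixed, the defining identity of the product of
  \<open>Z\<close> and \<open>X\<close> says that the adjoint of \<open>X\<close> is defined at
  \<open>dag D Z b\<close>. Its value there is given by the reversed product of the daggers.\<close>

lemma Lw_product:
  assumes X: "X \<in> Ldag D" and "Z \<in> Lw D X"
  shows "weak_product D (dag D X) (dag D Z) \<in> Ldag D"
    and "b \<in> D \<Longrightarrow> adjoint_rel X (the (dag D Z b)) (the (weak_product D (dag D X) (dag D Z) b))"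
proof -
  obtain P where P: "is_weak_product D Z X P" using assms(2) by (auto simp: Lw_def)
  have PL: "P \<in> Ldag D" using P by (simp add: is_weak_product_def)
  note eq = weak_product_eq[OF weak_product_dag[OF X P]]
  show "weak_product D (dag D X) (dag D Z) \<in> Ldag D" by (simp add: eq dag_Ldag[OF PL])
  show "adjoint_rel X (the (dag D Z b)) (the (weak_product D (dag D X) (dag D Z) b))" if "b \<in> D"
    using P that by (simp add: eq adjoint_rel_def dom_Ldag[OF X] is_weak_product_def Ldag_adjoint[OF PL])
qed

text \<open>Composing with \<open>X\<close> replaces the functional given by \<open>\<zeta>\<close>
  with the one given by \<open>\<zeta>'\<close>, so the product is again of rank one.\<close>

lemma rank_one_Lw:
  assumes X: "X \<in> Ldag D" and "adjoint_rel X \<zeta> \<zeta>'"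
  shows "rank_one b \<zeta> \<in> Lw D X"
proof -
  have "is_weak_product D (rank_one b \<zeta>) X (rank_one b \<zeta>')"
    using assms(2) by (simp add: is_weak_product_def rank_one_Ldag dag_rank_one adjoint_rel_def dom_Ldag[OF X]
        cinner_scaleC_left cinner_scaleC_right cinner_commute[of b])
  then show ?thesis by (auto simp: Lw_def rank_one_Ldag)
qed

text \<open>Left multipliers only produce pairs in the graph of the adjoint of \<open>X\<close>, and
  those of rank one produce all such pairs up to a scalar. The condition thus tests against the
  whole adjoint.\<close>

lemma Lw_condition_iff_closure:
  assumes X: "X \<in> Ldag D" and "Y \<in> Ldag D" and "W \<in> Ldag D"
  shows "(\<forall>Z\<in>Lw D X. \<forall>a\<in>D. \<forall>b\<in>D. cinner (the (W a)) (the (dag D Z b)) =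
      cinner (the (Y a)) (the (weak_product D (dag D X) (dag D Z) b))) \<longleftrightarrow>
    (\<forall>a\<in>D. (the (Y a), the (W a)) \<in> closure (Map.graph X))" (is "?l \<longleftrightarrow> ?r")
proof
  assume ?r
  then show ?l using Lw_product(2)[OF X] closure_graph_adjoint by blast
next
  assume l: ?l
  show ?r
  proof
    fix a assume a: "a \<in> D"
    show "(the (Y a), the (W a)) \<in> closure (Map.graph X)"
    proof (rule closure_graph_biadjoint)
      show "linear_operator X" using X by (simp add: Ldag_def)
      fix \<eta> \<zeta> assume rel: "adjoint_rel X \<eta> \<zeta>"
      show "cinner (the (W a)) \<eta> = cinner (the (Y a)) \<zeta>"
      proof (cases "a = 0")
        case False
        \<comment> \<open>The vector \<open>a\<close> doubles as range vector and as test vector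
          \<open>b\<close>, so \<open>dag D ?Z a\<close> is \<open>\<eta>\<close> times the nonzero
          scalar \<open>?c\<close>, which cancels at the end.\<close>
        let ?Z = "rank_one a \<eta>" and ?c = "cinner a a"
        let ?P = "the (weak_product D (dag D X) (dag D ?Z) a)"
        have Z: "?Z \<in> Lw D X" by (rule rank_one_Lw[OF X rel])
        have dag: "the (dag D ?Z a) = ?c *\<^sub>C \<eta>" using a by (simp add: dag_rank_one)
        have "adjoint_rel X (?c *\<^sub>C \<eta>) ?P" using Lw_product(2)[OF X Z a] dag by simp
        moreover have "adjoint_rel X (?c *\<^sub>C \<eta>) (?c *\<^sub>C \<zeta>)"
          using rel by (simp add: adjoint_rel_def cinner_scaleC_right)
        ultimately have "?P = ?c *\<^sub>C \<zeta>" by (rule adjoint_rel_unique[OF dom_Ldag[OF X]])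
        then have "cinner (the (W a)) (?c *\<^sub>C \<eta>) = cinner (the (Y a)) (?c *\<^sub>C \<zeta>)"
          using l Z a dag by metis
        then show ?thesis using False by (simp add: cinner_scaleC_right cinner_eq_zero_iff)
      qed (simp add: Ldag_zero assms)
    qed
  qed
qed

text \<open>The two domain inclusions give unrelated choices \<open>f\<close> and \<open>g\<close>
  of closure values. They are formal adjoints of each other, so \<open>f\<close> defines
  \<open>W\<close> and \<open>g\<close> is its dagger.\<close>

lemma strong_product_defined_iff:
  assumes X: "X \<in> Ldag D" and Y: "Y \<in> Ldag D"
  shows "strong_product_defined D X Y \<longleftrightarrow>
    (\<exists>W\<in>Ldag D. (\<forall>a\<in>D. (the (Y a), the (W a)) \<in> closure (Map.graph X)) \<and>
      (\<forall>a\<in>D. (the (dag D X a), the (dag D W a)) \<in> closure (Map.graph (dag D Y))))" (is "?l \<longleftrightarrow> ?r")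
proof
  assume ?r
  then show ?l unfolding strong_product_defined_def dom_closure_op by blast
next
  assume ?l
  then obtain f g where f: "\<And>\<xi>. \<xi> \<in> D \<Longrightarrow> (the (Y \<xi>), f \<xi>) \<in> closure (Map.graph X)"
    and g: "\<And>\<xi>. \<xi> \<in> D \<Longrightarrow> (the (dag D X \<xi>), g \<xi>) \<in> closure (Map.graph (dag D Y))"
    unfolding strong_product_defined_def dom_closure_op by metis
  \<comment> \<open>Both sides equal the inner product of \<open>Y \<xi>\<close> with
    \<open>dag D X \<eta>\<close>.\<close>
  have "cinner (f \<xi>) \<eta> = cinner \<xi> (g \<eta>)" if "\<xi> \<in> D" "\<eta> \<in> D" for \<xi> \<eta>
  proof -
    have "cinner (f \<xi>) \<eta> = cinner (the (Y \<xi>)) (the (dag D X \<eta>))"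
      by (rule closure_graph_adjoint[OF f[OF that(1)] Ldag_adjoint_rel[OF X that(2)]])
    moreover have "cinner (g \<eta>) \<xi> = cinner (the (dag D X \<eta>)) (the (Y \<xi>))"
      using closure_graph_adjoint[OF g[OF that(2)] Ldag_adjoint_rel[OF dag_Ldag[OF Y] that(1)]]
      by (simp add: dag_dag[OF Y])
    ultimately show ?thesis by (metis cinner_commute)
  qed
  note W = op_on_Ldag[OF this]
  show ?r using f g W by (intro bexI[of _ "op_on D f"]) simp_all
qed

text \<open>Both inclusions come from \<open>weak_product_dag\<close> and the involutivity of the
  dagger.\<close>

lemma dag_Lw_dag:
  assumes Y: "Y \<in> Ldag D"
  shows "dag D ` Lw D (dag D Y) = Rw D Y"
proof (intro equalityI subsetI)
  fix V assume "V \<in> dag D ` Lw D (dag D Y)"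
  then obtain Z P where Z: "Z \<in> Ldag D" "is_weak_product D Z (dag D Y) P" "V = dag D Z"
    by (auto simp: Lw_def)
  have "is_weak_product D Y V (dag D P)"
    using weak_product_dag[OF dag_Ldag[OF Y] Z(2)] Z(3) by (simp add: dag_dag[OF Y])
  then show "V \<in> Rw D Y" using Z by (auto simp: Rw_def dag_Ldag)
next
  fix V assume "V \<in> Rw D Y"
  then obtain P where V: "V \<in> Ldag D" "is_weak_product D Y V P" by (auto simp: Rw_def)
  have "is_weak_product D (dag D V) (dag D Y) (dag D P)" by (rule weak_product_dag[OF V])
  then have "dag D V \<in> Lw D (dag D Y)" by (auto simp: Lw_def dag_Ldag V(1))
  then show "V \<in> dag D ` Lw D (dag D Y)" by (metis dag_dag[OF V(1)] imageI)
qed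

lemma phi_condition_iff_closure:
  assumes "X \<in> Ldag D" "Y \<in> Ldag D" "W \<in> Ldag D"
  shows "(\<forall>Z\<in>Lw D X. \<forall>\<xi>\<in>D. \<forall>A\<in>PP D. \<forall>B\<in>PP D.
      phi \<xi> (weak_product D W A) (weak_product D (dag D Z) B) =
      phi \<xi> (weak_product D Y A) (weak_product D (weak_product D (dag D X) (dag D Z)) B)) \<longleftrightarrow>
    (\<forall>a\<in>D. (the (Y a), the (W a)) \<in> closure (Map.graph X))"
proof -
  have "Z \<in> Ldag D" if "Z \<in> Lw D X" for Z using that by (simp add: Lw_def)
  then show ?thesis
    unfolding Lw_condition_iff_closure[OF assms, symmetric]
    by (intro ball_cong refl phi_PP_eq_iff assms dag_Ldag Lw_product(1))
qed

end

theorem proposition3p8: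
  fixes D :: "'h::complex_hilbert set" and X Y :: "'h \<rightharpoonup> 'h"
  assumes "complex_vector.subspace D" and "closure D = UNIV"
    and "X \<in> Ldag D" and "Y \<in> Ldag D"
  shows "strong_product_defined D X Y \<longleftrightarrow>
    (\<exists>W\<in>Ldag D.
      (\<forall>Z\<in>Lw D X. \<forall>\<xi>\<in>D. \<forall>A\<in>PP D. \<forall>B\<in>PP D.
        phi \<xi> (weak_product D W A) (weak_product D (dag D Z) B) =
        phi \<xi> (weak_product D Y A) (weak_product D (weak_product D (dag D X) (dag D Z)) B)) \<and>
      (\<forall>V\<in>Rw D Y. \<forall>\<xi>\<in>D. \<forall>A\<in>PP D. \<forall>B\<in>PP D.
        phi \<xi> (weak_product D (dag D W) A) (weak_product D V B) =
        phi \<xi> (weak_product D (dag D X) A) (weak_product D (weak_product D Y V) B)))"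
proof -
  interpret dense_subspace D by (rule dense_subspace.intro[OF assms(1,2)])
  note X = assms(3) and Y = assms(4)
  have second: "(\<forall>V\<in>Rw D Y. \<forall>\<xi>\<in>D. \<forall>A\<in>PP D. \<forall>B\<in>PP D.
        phi \<xi> (weak_product D (dag D W) A) (weak_product D V B) =
        phi \<xi> (weak_product D (dag D X) A) (weak_product D (weak_product D Y V) B)) \<longleftrightarrow>
      (\<forall>a\<in>D. (the (dag D X a), the (dag D W a)) \<in> closure (Map.graph (dag D Y)))"
    if "W \<in> Ldag D" for W
    \<comment> \<open>Substituting \<open>V = dag D Z\<close> turns the quantifier over
      \<open>Rw D Y\<close> into one over \<open>Lw D (dag D Y)\<close>, and \<open>dag_dag\<close>
      restores the left factor \<open>Y\<close>.\<close>
    using phi_condition_iff_closure[OF dag_Ldag[OF Y] dag_Ldag[OF X] dag_Ldag[OF that]]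
    by (simp add: dag_Lw_dag[OF Y, symmetric] dag_dag[OF Y])
  show ?thesis
    unfolding strong_product_defined_iff[OF X Y]
    by (intro bex_cong refl) (simp only: phi_condition_iff_closure[OF X Y] second)
qed

end
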